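(* Let $X_1,X_2,\dots$ be i.i.d. real random variables with probability density $f$ and characteristic function $\varphi$, and let $f_n(x;h)$ be the sinc estimator of $f$. Suppose that $\varphi$ is integrable, $\int_{-\infty}^{\infty}|\varphi(t)|\,dt<\infty$, and that $f$ has a unique mode $\theta$. Let $h=h_n>0$ be a (deterministic) bandwidth sequence such that, as $n\to\infty$, $h\to0$ and $nh^2\to\infty$, and let $\theta_n$ be a mode of the sinc estimate $f_n(\cdot\,;h)$. Then $$\theta_n\to\theta\quad\text{in probability as } n\to\infty .$$
   Context: The characteristic function is $\varphi(t)=\mathrm{E}\,e^{itX_j}$. The sinc estimator with bandwidth $h>0$ is $f_n(x;h)=\frac{1}{\pi n}\sum_{j=1}^n\frac{\sin[(x-X_j)/h]}{x-X_j}$ (each summand being understood as $1/h$ when $x=X_j$). A mode of a function is a point at which it attains its global maximum over $\mathbb{R}$. Since $\varphi$ is integrable, $f$ is taken to be the uniformly continuous version of the density. *)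

theory Defs
  imports "HOL-Probability.Probability"
begin

definition is_mode :: "(real \<Rightarrow> real) \<Rightarrow> real \<Rightarrow> bool" where
  "is_mode g x \<longleftrightarrow> (\<forall>y. g y \<le> g x)"

(* The observations are X 1, X 2, ...; w is the sample point.  The value 1 / h is the
   continuous extension of the summand to x = X j w. *)
definition sinc_estimator :: "(nat \<Rightarrow> 'a \<Rightarrow> real) \<Rightarrow> nat \<Rightarrow> real \<Rightarrow> 'a \<Rightarrow> real \<Rightarrow> real" where
  "sinc_estimator X n h w x =
     1 / (pi * real n) *
       (\<Sum>j=1..n. if x = X j w then 1 / h else sin ((x - X j w) / h) / (x - X j w))"

(* Only meaningful for random variables Y n: measure is 0 on non-measurable sets. *)
definition converges_in_probability :: "'a measure \<Rightarrow> (nat \<Rightarrow> 'a \<Rightarrow> real) \<Rightarrow> real \<Rightarrow> bool" where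
  "converges_in_probability M Y c \<longleftrightarrow>
     (\<forall>\<epsilon>>0. (\<lambda>n. measure M {w \<in> space M. \<bar>Y n w - c\<bar> > \<epsilon>}) \<longlonglongrightarrow> 0)"

end

theory Submission
  imports Defs
begin

text \<open>
  The mode of \<open>f\<close> is consistently estimated because the sinc estimate is uniformly close to \<open>f\<close> with
  high probability, and because a function uniformly close to \<open>f\<close> can only have its modes where \<open>f\<close> is
  nearly maximal.

  Uniform closeness is seen on the Fourier side.  As \<open>\<phi>\<close> is integrable, the continuous density is
  everywhere the inverse Fourier integral of \<open>\<phi>\<close> (\<open>continuous_density_eq_inverse_Fourier\<close>), and the sinc
  estimate is the inverse Fourier integral of the empirical characteristic function restricted to
  \<open>\<bar>t\<bar> \<le> 1 / h\<close> (\<open>sinc_estimator_eq_truncated_inversion\<close>).  Hence the supremum of the error is, up to the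
  factor \<open>1 / (2 * pi)\<close>, at most a random part, the integral of the deviation of the empirical
  characteristic function from \<open>\<phi>\<close> over \<open>\<bar>t\<bar> \<le> 1 / h\<close>, plus a deterministic part, the integral of \<open>\<bar>\<phi>\<bar>\<close>
  over \<open>\<bar>t\<bar> > 1 / h\<close> (\<open>sinc_estimator_error_le\<close>).  The deterministic part vanishes as \<open>h\<close> tends to 0.  The
  deviation at each \<open>t\<close> has mean of order \<open>1 / sqrt n\<close>, so the random part has mean of order
  \<open>1 / (h * sqrt n)\<close>, which vanishes because \<open>n * h\<^sup>2\<close> tends to infinity
  (\<open>prob_integrated_empirical_char_deviation_ge\<close>).

  For the second point, \<open>f\<close> is uniformly continuous and integrable and thus vanishes at infinity
  (\<open>vanishes_at_infinity\<close>), so by compactness its values at distance more than \<open>\<epsilon>\<close> from the unique mode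
  \<open>\<theta>\<close> stay below \<open>f \<theta> - \<delta>\<close> for some \<open>\<delta> > 0\<close> (\<open>unique_mode_well_separated\<close>).  An estimated mode that far from
  \<open>\<theta>\<close> requires an error of at least \<open>\<delta> / 2\<close> somewhere, an event whose probability tends to 0.
\<close>

section \<open>Fourier inversion for an integrable characteristic function\<close>

text \<open>
  The scaled mass is the difference quotient of the distribution function for the increment
  \<open>1 / (n + 1)\<close>, so this is the fundamental theorem of calculus.
\<close>
lemma tendsto_average_of_continuous_density:
  fixes f :: "real \<Rightarrow> real"
  assumes nonneg: "\<And>x. f x \<ge> 0" and cont: "continuous_on UNIV f"
  shows "(\<lambda>n. real (Suc n) * measure (density lborel (\<lambda>x. ennreal (f x))) {x<..x + 1 / real (Suc n)}) \<longlonglongrightarrow> f x"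
proof -
  let ?P = "density lborel (\<lambda>x. ennreal (f x))"
  let ?G = "\<lambda>u. LBINT y=x..u. f y"
  have [measurable]: "f \<in> borel_measurable borel"
    using cont by (rule borel_measurable_continuous_onI)
  have P: "measure ?P {x<..u} = ?G u" if "x \<le> u" for u
  proof -
    have int: "integrable lborel (\<lambda>y. indicator {x..u} y *\<^sub>R f y)"
      by (rule borel_integrable_compact) (auto intro: continuous_on_subset[OF cont])
    have "integrable lborel (\<lambda>y. indicator {x<..u} y *\<^sub>R (indicator {x..u} y *\<^sub>R f y))"
      by (rule integrable_mult_indicator[OF _ int]) auto
    also have "(\<lambda>y. indicator {x<..u} y *\<^sub>R (indicator {x..u} y *\<^sub>R f y)) = (\<lambda>y. f y * indicator {x<..u} y)"
      by (auto simp: fun_eq_iff split: split_indicator)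
    finally have int': "integrable lborel (\<lambda>y. f y * indicator {x<..u} y)" .
    have "emeasure ?P {x<..u} = (\<integral>\<^sup>+y. ennreal (f y * indicator {x<..u} y) \<partial>lborel)"
      by (subst emeasure_density) (auto intro!: nn_integral_cong split: split_indicator)
    also have "\<dots> = ennreal (\<integral>y. f y * indicator {x<..u} y \<partial>lborel)"
      using int' nonneg by (intro nn_integral_eq_integral) auto
    also have "(\<integral>y. f y * indicator {x<..u} y \<partial>lborel) = ?G u"
      using that by (simp add: interval_integral_Ioc set_lebesgue_integral_def mult.commute)
    finally have e: "emeasure ?P {x<..u} = ennreal (?G u)" .
    have "0 \<le> ?G u"
      using that nonneg by (simp add: interval_integral_Ioc set_lebesgue_integral_def)
    with e show ?thesis by (simp add: measure_def)
  qed
  have "(?G has_vector_derivative f x) (at x within {x..x + 1})"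
    by (rule interval_integral_FTC2) (auto intro: continuous_on_subset[OF cont])
  then have "((\<lambda>u. (?G u - ?G x) / (u - x)) \<longlongrightarrow> f x) (at x within {x..x + 1})"
    by (simp add: has_real_derivative_iff_has_vector_derivative[symmetric] has_field_derivative_iff)
  moreover have "filterlim (\<lambda>n. x + 1 / real (Suc n)) (at x within {x..x + 1}) sequentially"
    unfolding filterlim_at
  proof
    have "(\<lambda>n. x + 1 / real (Suc n)) \<longlonglongrightarrow> x + 0"
      using LIMSEQ_inverse_real_of_nat by (intro tendsto_add tendsto_const) (simp add: inverse_eq_divide)
    then show "(\<lambda>n. x + 1 / real (Suc n)) \<longlonglongrightarrow> x" by simp
  qed (auto simp: field_simps)
  ultimately have "(\<lambda>n. (?G (x + 1 / real (Suc n)) - ?G x) / (x + 1 / real (Suc n) - x)) \<longlonglongrightarrow> f x"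
    by (rule filterlim_compose)
  then show ?thesis
    by (simp add: P field_simps)
qed

text \<open>
  Levy's inversion formula only gives a limit of integrals over \<open>[-T, T]\<close>.  If the characteristic
  function is integrable, \<open>b - a\<close> times its modulus dominates the integrand, and the limit becomes a
  Lebesgue integral, to which dominated convergence can be applied once more when the interval shrinks
  to a point.
\<close>
lemma measure_Ioc_eq_inversion_integral:
  assumes "real_distribution P" and int: "integrable lborel (char P)"
    and atom: "\<And>x. measure P {x} = 0" and "a \<le> b"
  shows "complex_of_real (measure P {a<..b}) =
    1 / (2 * pi) * (CLBINT t. (iexp (-(t * a)) - iexp (-(t * b))) / (\<i> * t) * char P t)"
proof -
  interpret real_distribution P by fact
  let ?K = "\<lambda>t::real. (iexp (-(t * a)) - iexp (-(t * b))) / (\<i> * t)"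
  have "AE t in lborel. cmod (?K t) \<le> b - a"
    using Levy_Inversion_aux2[of "-b" "-a"] \<open>a \<le> b\<close>
    by (intro AE_I[of _ _ "{0}"]) auto
  then have bound: "AE t in lborel. cmod (?K t * char P t) \<le> (b - a) * cmod (char P t)"
    by eventually_elim (unfold norm_mult, rule mult_right_mono, auto)
  have "(\<lambda>T::nat. CLBINT t. indicator {-real T<..<real T} t *\<^sub>R (?K t * char P t))
      \<longlonglongrightarrow> (CLBINT t. ?K t * char P t)"
  proof (rule integral_dominated_convergence[where w="\<lambda>t. (b - a) * cmod (char P t)"])
    show "AE t in lborel. (\<lambda>T::nat. indicator {-real T<..<real T} t *\<^sub>R (?K t * char P t)) \<longlonglongrightarrow> ?K t * char P t"
    proof (rule AE_I2)
      fix t :: real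
      obtain N :: nat where "\<bar>t\<bar> < real N" using reals_Archimedean2 by blast
      then have "\<forall>\<^sub>F T in sequentially. indicator {-real T<..<real T} t *\<^sub>R (?K t * char P t) = ?K t * char P t"
        by (intro eventually_sequentiallyI[of N]) (auto simp: abs_less_iff)
      then show "(\<lambda>T::nat. indicator {-real T<..<real T} t *\<^sub>R (?K t * char P t)) \<longlonglongrightarrow> ?K t * char P t"
        by (rule tendsto_eventually)
    qed
    show "AE t in lborel. cmod (indicator {-real T<..<real T} t *\<^sub>R (?K t * char P t)) \<le> (b - a) * cmod (char P t)" for T :: nat
      using bound
    proof eventually_elim
      case (elim t)
      then show ?case using \<open>a \<le> b\<close> by (auto split: split_indicator)
    qed
  qed (use int in auto)
  moreover have "(CLBINT t. indicator {-real T<..<real T} t *\<^sub>R (?K t * char P t)) = (CLBINT t=-T..T. ?K t * char P t)" for T :: nat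
    by (simp add: interval_lebesgue_integral_def set_lebesgue_integral_def)
  ultimately have "(\<lambda>T::nat. 1 / (2 * pi) * (CLBINT t=-T..T. ?K t * char P t)) \<longlonglongrightarrow> 1 / (2 * pi) * (CLBINT t. ?K t * char P t)"
    by (intro tendsto_mult tendsto_const) simp
  with Levy_Inversion[OF \<open>a \<le> b\<close> atom atom]
  show "complex_of_real (measure P {a<..b}) = 1 / (2 * pi) * (CLBINT t. ?K t * char P t)"
    by (rule LIMSEQ_unique)
qed

text \<open>
  Fourier inversion at every point.  Divide the formula for the mass of \<open>{x<..b}\<close> by \<open>b - x\<close> and let
  \<open>b\<close> decrease to \<open>x\<close>.  On the left the average of the density tends to \<open>f x\<close> by continuity; on the
  right the quotient of the kernel has modulus at most 1 and tends to \<open>iexp (-(t * x))\<close>.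
\<close>
lemma continuous_density_eq_inverse_Fourier:
  fixes f :: "real \<Rightarrow> real"
  defines "P \<equiv> density lborel (\<lambda>x. ennreal (f x))"
  assumes nonneg: "\<And>x. f x \<ge> 0" and cont: "continuous_on UNIV f"
    and P: "real_distribution P" and int: "integrable lborel (char P)"
  shows "complex_of_real (f x) = 1 / (2 * pi) * (CLBINT t. iexp (-(t * x)) * char P t)"
proof -
  interpret real_distribution P by fact
  have [measurable]: "f \<in> borel_measurable borel"
    using cont by (rule borel_measurable_continuous_onI)
  have atom: "measure P {x} = 0" for x
  proof -
    have "AE y in lborel. y \<in> {x} \<longrightarrow> ennreal (f y) = 0"
      by (rule AE_I[of _ _ "{x}"]) auto
    then have "{x} \<in> null_sets P"
      unfolding P_def by (subst null_sets_density_iff) auto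
    then show ?thesis by (auto simp: measure_def)
  qed
  let ?b = "\<lambda>n. x + 1 / real (Suc n)"
  let ?K = "\<lambda>n t. real (Suc n) * ((iexp (-(t * x)) - iexp (-(t * ?b n))) / (\<i> * complex_of_real t))"
  have eq: "complex_of_real (real (Suc n) * measure P {x<..?b n}) = 1 / (2 * pi) * (CLBINT t. ?K n t * char P t)" for n
  proof -
    have "complex_of_real (real (Suc n) * measure P {x<..?b n}) = 1 / (2 * pi) * (real (Suc n) * (CLBINT t. (iexp (-(t * x)) - iexp (-(t * ?b n))) / (\<i> * t) * char P t))"
      using measure_Ioc_eq_inversion_integral[OF P int atom, of x "?b n"] by simp
    also have "(real (Suc n) * (CLBINT t. (iexp (-(t * x)) - iexp (-(t * ?b n))) / (\<i> * t) * char P t)) = (CLBINT t. ?K n t * char P t)"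
      by (subst Bochner_Integration.integral_mult_right_zero[symmetric]) (simp only: mult.assoc)
    finally show ?thesis .
  qed
  have nonzero: "AE t in lborel. t \<noteq> (0::real)"
    by (rule AE_I[of _ _ "{0}"]) auto
  have "(\<lambda>n. CLBINT t. ?K n t * char P t) \<longlonglongrightarrow> (CLBINT t. iexp (-(t * x)) * char P t)"
  proof (rule integral_dominated_convergence[where w="\<lambda>t. cmod (char P t)"])
    show "AE t in lborel. (\<lambda>n. ?K n t * char P t) \<longlonglongrightarrow> iexp (-(t * x)) * char P t"
      using nonzero
    proof eventually_elim
      case t: (elim t)
      \<comment> \<open>The kernel is a difference quotient of \<open>exp (-\<i>tz)\<close> at \<open>z = x\<close>, divided by \<open>-\<i>t\<close>.\<close>
      let ?F = "\<lambda>z::complex. exp (- (\<i> * t * z))"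
      have "(?F has_field_derivative (- (\<i> * t) * ?F x)) (at (complex_of_real x))"
        by (auto intro!: derivative_eq_intros)
      then have "((\<lambda>z::complex. (?F (x + z) - ?F x) / z) \<longlongrightarrow> - (\<i> * t) * ?F x) (at 0)"
        by (simp add: DERIV_def)
      moreover have "filterlim (\<lambda>n. complex_of_real (1 / real (Suc n))) (at 0) sequentially"
        unfolding filterlim_at
      proof
        show "(\<lambda>n. complex_of_real (1 / real (Suc n))) \<longlonglongrightarrow> 0"
          using tendsto_of_real[OF LIMSEQ_inverse_real_of_nat, where 'a=complex]
          by (simp add: inverse_eq_divide)
      qed (auto simp del: of_nat_Suc)
      ultimately have "(\<lambda>n. (?F (x + complex_of_real (1 / real (Suc n))) - ?F x) / complex_of_real (1 / real (Suc n))) \<longlonglongrightarrow> - (\<i> * t) * ?F x"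
        by (rule filterlim_compose)
      then have "(\<lambda>n. - ((?F (x + complex_of_real (1 / real (Suc n))) - ?F x) / complex_of_real (1 / real (Suc n))) / (\<i> * t) * char P t) \<longlonglongrightarrow> - (- (\<i> * t) * ?F x) / (\<i> * t) * char P t"
        using t by (intro tendsto_intros) auto
      also have "(\<lambda>n. - ((?F (x + complex_of_real (1 / real (Suc n))) - ?F x) / complex_of_real (1 / real (Suc n))) / (\<i> * t) * char P t) = (\<lambda>n. ?K n t * char P t)"
        using t by (intro ext) (simp add: divide_simps mult_ac del: of_nat_Suc, simp add: right_diff_distrib del: of_nat_Suc)
      also have "- (- (\<i> * t) * ?F x) / (\<i> * t) * char P t = iexp (-(t * x)) * char P t"
        using t by (simp add: mult_ac)
      finally show ?case .
    qed
    show "AE t in lborel. cmod (?K n t * char P t) \<le> cmod (char P t)" for n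
      using nonzero
    proof eventually_elim
      case t: (elim t)
      have "cmod (?K n t) \<le> real (Suc n) * (1 / real (Suc n))"
        unfolding norm_mult norm_of_real
        using Levy_Inversion_aux2[of "-?b n" "-x" t, unfolded mult_minus_right] t
        by (intro mult_mono) (auto simp del: of_nat_Suc of_real_add of_real_divide of_real_diff)
      then have "cmod (?K n t) \<le> 1" by simp
      then show ?case
        unfolding norm_mult by (intro mult_left_le_one_le) auto
    qed
  qed (use int in auto)
  then have "(\<lambda>n. complex_of_real (real (Suc n) * measure P {x<..?b n})) \<longlonglongrightarrow>
      1 / (2 * pi) * (CLBINT t. iexp (-(t * x)) * char P t)"
    unfolding eq by (intro tendsto_mult tendsto_const)
  moreover have "(\<lambda>n. complex_of_real (real (Suc n) * measure P {x<..?b n})) \<longlonglongrightarrow> complex_of_real (f x)"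
    unfolding P_def by (intro tendsto_of_real tendsto_average_of_continuous_density nonneg cont)
  ultimately show ?thesis
    by (rule LIMSEQ_unique[rotated])
qed

section \<open>The sinc estimate as a truncated Fourier integral\<close>

text \<open>
  The sinc kernel is the Fourier transform of the indicator of an interval.
\<close>
lemma integral_iexp_symmetric:
  fixes c T :: real
  assumes "T \<ge> 0"
  shows "(CLBINT t. indicator {-T..T} t *\<^sub>R iexp (t * c)) =
    complex_of_real (if c = 0 then 2 * T else 2 * sin (T * c) / c)"
proof (cases "c = 0")
  case True
  then show ?thesis
    using assms by (simp add: scaleR_conv_of_real integral_complex_of_real)
next
  case False
  have "(CLBINT t. indicator {-T..T} t *\<^sub>R iexp (t * c)) = iexp (T * c) / (\<i> * c) - iexp (- T * c) / (\<i> * c)"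
  proof (rule integral_FTC_Icc)
    show "((\<lambda>t. iexp (t * c) / (\<i> * c)) has_vector_derivative iexp (t * c)) (at t within {-T..T})" for t
    proof -
      have "((\<lambda>z. exp (\<i> * (z * c)) / (\<i> * c)) has_field_derivative exp (\<i> * (t * c))) (at (complex_of_real t) within complex_of_real ` {-T..T})"
        using False by (auto intro!: derivative_eq_intros simp: mult_ac)
      from field_vector_diff_chain_within[OF has_vector_derivative_of_real[OF DERIV_ident] this]
      show ?thesis by (simp add: o_def)
    qed
  qed (use assms in \<open>auto intro!: continuous_intros\<close>)
  also have "\<dots> = complex_of_real (2 * sin (T * c) / c)"
    using False by (simp add: complex_eq_iff Re_divide Im_divide Re_exp Im_exp power2_eq_square)
  finally show ?thesis
    using False by simp
qed

definition empirical_char :: "(nat \<Rightarrow> 'a \<Rightarrow> real) \<Rightarrow> nat \<Rightarrow> 'a \<Rightarrow> real \<Rightarrow> complex" where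
  "empirical_char X n w t = (\<Sum>j=1..n. iexp (t * X j w)) / n"

lemma cmod_empirical_char_le_1: "cmod (empirical_char X n w t) \<le> 1"
proof (cases "n = 0")
  case False
  have "cmod (\<Sum>j=1..n. iexp (t * X j w)) \<le> n"
    using sum_norm_bound[of "{1..n}" "\<lambda>j. iexp (t * X j w)" 1] by simp
  with False show ?thesis
    by (simp add: empirical_char_def norm_divide)
qed (simp add: empirical_char_def)

lemma integrable_indicator_continuous:
  fixes g :: "real \<Rightarrow> complex"
  assumes "continuous_on UNIV g"
  shows "integrable lborel (\<lambda>t. indicator {a..b} t *\<^sub>R g t)"
  by (rule borel_integrable_compact) (auto intro: continuous_on_subset[OF assms])

text \<open>
  The sinc estimate is what the inversion formula yields when the characteristic function is replaced
  by its empirical counterpart; the cut-off at \<open>\<bar>t\<bar> = 1 / h\<close> makes a sum of exponentials integrable.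
\<close>
lemma sinc_estimator_eq_truncated_inversion:
  assumes "h > 0"
  shows "complex_of_real (sinc_estimator X n h w x) =
    1 / (2 * pi) * (CLBINT t. indicator {-(1/h)..1/h} t *\<^sub>R (iexp (-(t * x)) * empirical_char X n w t))"
proof -
  let ?I = "indicator {-(1/h)..1/h} :: real \<Rightarrow> real"
  have "(CLBINT t. ?I t *\<^sub>R (iexp (-(t * x)) * empirical_char X n w t))
    = (CLBINT t. (\<Sum>j=1..n. ?I t *\<^sub>R iexp (t * (X j w - x))) / n)"
    by (rule Bochner_Integration.integral_cong)
       (simp_all add: empirical_char_def sum_distrib_left scaleR_sum_right sum_divide_distrib exp_diff exp_minus field_simps)
  also have "\<dots> = (\<Sum>j=1..n. CLBINT t. ?I t *\<^sub>R iexp (t * (X j w - x))) / n"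
    by (subst integral_divide_zero, subst Bochner_Integration.integral_sum)
       (auto intro!: integrable_indicator_continuous continuous_intros)
  also have "\<dots> = (\<Sum>j=1..n. complex_of_real (2 * (if x = X j w then 1 / h else sin ((x - X j w) / h) / (x - X j w)))) / n"
  proof (intro arg_cong2[where f="(/)"] sum.cong refl)
    fix j
    \<comment> \<open>The convention \<open>1 / h\<close> at \<open>x = X j w\<close> is the value that the integral gives there.\<close>
    have "sin ((X j w - x) / h) = - sin ((x - X j w) / h)"
      by (metis minus_diff_eq minus_divide_left sin_minus)
    then show "(CLBINT t. ?I t *\<^sub>R iexp (t * (X j w - x))) = complex_of_real (2 * (if x = X j w then 1 / h else sin ((x - X j w) / h) / (x - X j w)))"
      using assms by (subst integral_iexp_symmetric) (auto simp: field_simps)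
  qed
  finally show ?thesis
    by (simp add: sinc_estimator_def sum_distrib_left[symmetric])
qed

text \<open>
  Both \<open>f\<close> and its estimate are inverse Fourier integrals, and \<open>iexp\<close> has modulus 1; so their difference
  is bounded by the \<open>L\<^sup>1\<close> distance of the transforms, in a form that does not depend on \<open>x\<close>.  Uniformity
  in \<open>x\<close> matters, since the bound will be used at a random point.
\<close>
lemma sinc_estimator_error_le:
  assumes "h > 0" and int: "integrable lborel \<phi>"
    and f: "complex_of_real (f x) = 1 / (2 * pi) * (CLBINT t. iexp (-(t * x)) * \<phi> t)"
  shows "\<bar>sinc_estimator X n h w x - f x\<bar> \<le> 1 / (2 * pi) *
    ((LBINT t. indicator {-(1/h)..1/h} t *\<^sub>R norm (empirical_char X n w t - \<phi> t))
     + (LBINT t. indicator (- {-(1/h)..1/h}) t *\<^sub>R norm (\<phi> t)))"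
proof -
  let ?I = "indicator {-(1/h)..1/h} :: real \<Rightarrow> real" and ?J = "indicator (- {-(1/h)..1/h}) :: real \<Rightarrow> real"
  let ?e = "empirical_char X n w" 
  let ?E = "\<lambda>t. ?I t *\<^sub>R (iexp (-(t * x)) * ?e t)"
  let ?F = "\<lambda>t. iexp (-(t * x)) * \<phi> t"
  have cont: "continuous_on UNIV ?e"
    unfolding empirical_char_def by (cases "n = 0") (auto intro!: continuous_intros)
  have [measurable]: "\<phi> \<in> borel_measurable lborel" using int by auto
  have intE: "integrable lborel ?E"
    by (intro integrable_indicator_continuous continuous_intros cont)
  have intF: "integrable lborel ?F"
    by (rule Bochner_Integration.integrable_bound[OF int]) (auto simp: norm_mult)
  have int1: "integrable lborel (\<lambda>t. ?I t *\<^sub>R norm (?e t - \<phi> t))"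
  proof -
    have "integrable lborel (\<lambda>t. ?I t *\<^sub>R ?e t - ?I t *\<^sub>R \<phi> t)"
      by (intro Bochner_Integration.integrable_diff integrable_indicator_continuous cont integrable_mult_indicator int) auto
    then have "integrable lborel (\<lambda>t. norm (?I t *\<^sub>R ?e t - ?I t *\<^sub>R \<phi> t))"
      by (rule integrable_norm)
    then show ?thesis
      by (simp add: scaleR_diff_right[symmetric])
  qed
  have int2: "integrable lborel (\<lambda>t. ?J t *\<^sub>R norm (\<phi> t))"
    by (intro integrable_mult_indicator integrable_norm int) auto
  have "complex_of_real (sinc_estimator X n h w x - f x) = 1 / (2 * pi) * (CLBINT t. ?E t - ?F t)"
    unfolding of_real_diff f sinc_estimator_eq_truncated_inversion[OF \<open>h > 0\<close>]
    by (simp only: Bochner_Integration.integral_diff[OF intE intF] right_diff_distrib)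
  then have eq: "\<bar>sinc_estimator X n h w x - f x\<bar> = norm (1 / (2 * pi) * (CLBINT t. ?E t - ?F t))"
    by (metis norm_of_real real_norm_def)
  have "norm (CLBINT t. ?E t - ?F t) \<le> (LBINT t. ?I t *\<^sub>R norm (?e t - \<phi> t) + ?J t *\<^sub>R norm (\<phi> t))"
  proof (rule Bochner_Integration.integral_norm_bound_integral)
    show "norm (?E t - ?F t) \<le> ?I t *\<^sub>R norm (?e t - \<phi> t) + ?J t *\<^sub>R norm (\<phi> t)" for t
      by (cases "t \<in> {-(1/h)..1/h}") (simp_all add: norm_mult flip: right_diff_distrib)
  qed (intro Bochner_Integration.integrable_diff Bochner_Integration.integrable_add intE intF int1 int2)+
  also have "\<dots> = (LBINT t. ?I t *\<^sub>R norm (?e t - \<phi> t)) + (LBINT t. ?J t *\<^sub>R norm (\<phi> t))"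
    by (rule Bochner_Integration.integral_add[OF int1 int2])
  finally show ?thesis
    unfolding eq by (simp add: norm_mult norm_divide divide_right_mono)
qed

section \<open>Deviation of the empirical characteristic function\<close>

text \<open>
  Centred independent variables are orthogonal in \<open>L\<^sup>2\<close>, so the second moment of the sum grows only
  linearly in the number of summands; the first moment is then controlled by Jensen's inequality.
\<close>
lemma (in prob_space) expectation_norm_sum_centred_indep_le:
  fixes Z :: "'i \<Rightarrow> 'a \<Rightarrow> complex"
  assumes "finite I" and indep: "indep_vars (\<lambda>_. borel) Z I"
    and mean: "\<And>i. i \<in> I \<Longrightarrow> expectation (Z i) = 0"
    and bound: "\<And>i w. i \<in> I \<Longrightarrow> norm (Z i w) \<le> B"
  shows "expectation (\<lambda>w. norm (\<Sum>i\<in>I. Z i w)) \<le> B * sqrt (card I)"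
proof (cases "I = {}")
  case False
  then have B: "B \<ge> 0" using bound norm_ge_zero order_trans by blast
  have meas[measurable]: "Z i \<in> borel_measurable M" if "i \<in> I" for i
    using indep that by (auto simp: indep_vars_def)
  have int: "integrable M (Z i)" if "i \<in> I" for i
    using that bound by (intro integrable_const_bound[where B=B]) auto
  have [measurable]: "cnj \<in> borel_measurable borel"
    by (intro borel_measurable_continuous_onI continuous_intros)
  have int2: "integrable M (\<lambda>w. Z i w * cnj (Z j w))" if "i \<in> I" "j \<in> I" for i j
    using that bound B
    by (intro integrable_const_bound[where B="B * B"]) (auto simp: norm_mult intro!: mult_mono)
  have uncorrelated: "expectation (\<lambda>w. Z i w * cnj (Z j w)) = 0" if "i \<in> I" "j \<in> I" "i \<noteq> j" for i j
  proof -
    \<comment> \<open>The product rule for independent variables is applied to \<open>Z i\<close> and the conjugate of \<open>Z j\<close>.\<close>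
    let ?Y = "\<lambda>k w. (if k = i then id else cnj) (Z k w)"
    have "indep_vars (\<lambda>_. borel) ?Y {i, j}"
      using that by (intro indep_vars_compose2[OF indep_vars_subset[OF indep]]) auto
    then have "expectation (\<lambda>w. \<Prod>k\<in>{i, j}. ?Y k w) = (\<Prod>k\<in>{i, j}. expectation (?Y k))"
      using that int by (intro indep_vars_lebesgue_integral) auto
    then show ?thesis
      using that mean by simp
  qed
  let ?S = "\<lambda>w. \<Sum>i\<in>I. Z i w"
  have [measurable]: "?S \<in> borel_measurable M"
    by (intro borel_measurable_sum) auto
  have S: "norm (?S w) \<le> card I * B" for w
    using bound by (intro order_trans[OF norm_sum] sum_bounded_above) auto
  have intS: "integrable M (\<lambda>w. norm (?S w))"
    using S by (intro integrable_const_bound[where B="card I * B"]) auto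
  have intS2: "integrable M (\<lambda>w. (norm (?S w))\<^sup>2)"
    using S B by (intro integrable_const_bound[where B="(card I * B)\<^sup>2"]) (auto intro!: power_mono)
  have "complex_of_real (expectation (\<lambda>w. (norm (?S w))\<^sup>2)) = expectation (\<lambda>w. complex_of_real ((norm (?S w))\<^sup>2))"
    by (simp add: integral_complex_of_real del: of_real_power)
  also have "\<dots> = expectation (\<lambda>w. \<Sum>i\<in>I. \<Sum>j\<in>I. Z i w * cnj (Z j w))"
    by (simp only: complex_norm_square cnj_sum sum_product)
  also have "\<dots> = (\<Sum>i\<in>I. \<Sum>j\<in>I. expectation (\<lambda>w. Z i w * cnj (Z j w)))"
    using int2 by (simp add: Bochner_Integration.integral_sum)
  also have "\<dots> = (\<Sum>i\<in>I. \<Sum>j\<in>I. if j = i then expectation (\<lambda>w. Z i w * cnj (Z i w)) else 0)"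
    by (intro sum.cong refl) (auto simp: uncorrelated)
  also have "\<dots> = (\<Sum>i\<in>I. expectation (\<lambda>w. Z i w * cnj (Z i w)))"
    using \<open>finite I\<close> by simp
  also have "\<dots> = complex_of_real (\<Sum>i\<in>I. expectation (\<lambda>w. (norm (Z i w))\<^sup>2))"
    by (simp add: complex_norm_square[symmetric] integral_complex_of_real del: of_real_power)
  finally have "expectation (\<lambda>w. (norm (?S w))\<^sup>2) = (\<Sum>i\<in>I. expectation (\<lambda>w. (norm (Z i w))\<^sup>2))"
    using of_real_eq_iff by blast
  also have "\<dots> \<le> (\<Sum>i\<in>I. B\<^sup>2)"
    using bound B by (intro sum_mono integral_le_const integrable_const_bound[where B="B\<^sup>2"]) (auto intro!: power_mono)
  finally have second: "expectation (\<lambda>w. (norm (?S w))\<^sup>2) \<le> card I * B\<^sup>2"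
    by simp
  \<comment> \<open>The variance of the norm is nonnegative, so the second moment controls the first.\<close>
  have "(expectation (\<lambda>w. norm (?S w)))\<^sup>2 \<le> expectation (\<lambda>w. (norm (?S w))\<^sup>2)"
    using variance_eq[OF intS intS2] variance_positive[of "\<lambda>w. norm (?S w)"] by simp
  with second have "(expectation (\<lambda>w. norm (?S w)))\<^sup>2 \<le> (B * sqrt (card I))\<^sup>2"
    by (simp add: power_mult_distrib mult.commute)
  then show ?thesis
    using B by (rule power2_le_imp_le[OF _ mult_nonneg_nonneg]) auto
qed auto

lemma (in prob_space) expectation_empirical_char_deviation_le:
  assumes indep: "indep_vars (\<lambda>_. borel) X {1..}"
    and ident: "\<And>j t. j \<ge> 1 \<Longrightarrow> char (distr M borel (X j)) t = \<phi> t" and "n \<ge> 1"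
  shows "expectation (\<lambda>w. norm (empirical_char X n w t - \<phi> t)) \<le> 2 / sqrt n"
proof -
  let ?Z = "\<lambda>j w. iexp (t * X j w) - \<phi> t"
  have rv[measurable]: "X j \<in> borel_measurable M" if "j \<ge> 1" for j
    using indep that by (auto simp: indep_vars_def)
  have phi: "\<phi> t = expectation (\<lambda>w. iexp (t * X j w))" if "j \<ge> 1" for j
    using that by (simp add: ident[symmetric] char_def integral_distr)
  have "indep_vars (\<lambda>_. borel) X {1..n}"
    by (rule indep_vars_subset[OF indep]) auto
  then have "indep_vars (\<lambda>_. borel) ?Z {1..n}"
    by (rule indep_vars_compose2) auto
  moreover have "expectation (?Z j) = 0" if "j \<in> {1..n}" for j
    using that phi[of j] by (subst Bochner_Integration.integral_diff) (auto simp: prob_space integrable_iexp)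
  moreover have "norm (?Z j w) \<le> 2" for j w
  proof -
    have "norm (\<phi> t) \<le> 1"
      using real_distribution.cmod_char_le_1[OF real_distribution_distr[OF rv[of 1]]] ident[of 1] by simp
    then show ?thesis
      using norm_triangle_ineq4[of "iexp (t * X j w)" "\<phi> t"] by simp
  qed
  ultimately have sum: "expectation (\<lambda>w. norm (\<Sum>j=1..n. ?Z j w)) \<le> 2 * sqrt n"
    using expectation_norm_sum_centred_indep_le[of "{1..n}" ?Z 2] by simp
  have "norm (empirical_char X n w t - \<phi> t) = norm (\<Sum>j=1..n. ?Z j w) / n" for w
  proof -
    have "empirical_char X n w t - \<phi> t = (\<Sum>j=1..n. ?Z j w) / n"
      using \<open>n \<ge> 1\<close> by (simp add: empirical_char_def sum_subtractf field_simps)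
    then show ?thesis by (simp add: norm_divide)
  qed
  then have "expectation (\<lambda>w. norm (empirical_char X n w t - \<phi> t)) = expectation (\<lambda>w. norm (\<Sum>j=1..n. ?Z j w)) / n"
    by simp
  also have "\<dots> \<le> 2 * sqrt n / n"
    using sum by (intro divide_right_mono) auto
  also have "\<dots> = 2 / sqrt n"
    using \<open>n \<ge> 1\<close> by (simp add: field_simps)
  finally show ?thesis .
qed

text \<open>
  Since the pointwise bound \<open>2 / sqrt n\<close> does not depend on \<open>t\<close>, Fubini's theorem bounds the expectation
  of the integrated deviation by \<open>2 * T * (2 / sqrt n)\<close>, and Markov's inequality does the rest.  With
  \<open>T = 1 / h\<close> this is where the condition that \<open>n * h\<^sup>2\<close> tends to infinity comes from.
\<close>
lemma (in prob_space) prob_integrated_empirical_char_deviation_ge: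
  assumes indep: "indep_vars (\<lambda>_. borel) X {1..}"
    and ident: "\<And>j t. j \<ge> 1 \<Longrightarrow> char (distr M borel (X j)) t = \<phi> t" and "n \<ge> 1" "T \<ge> 0" "c > 0"
  defines "D \<equiv> \<lambda>w. LBINT t. indicator {-T..T} t *\<^sub>R norm (empirical_char X n w t - \<phi> t)"
  shows "D \<in> borel_measurable M"
    and "prob {w \<in> space M. D w \<ge> c} \<le> 4 * T / (c * sqrt n)"
proof -
  interpret pair_sigma_finite M lborel ..
  have [measurable]: "X j \<in> borel_measurable M" if "j \<in> {1..n}" for j
    using indep that by (auto simp: indep_vars_def)
  have dist: "real_distribution (distr M borel (X 1))"
    using indep by (intro real_distribution_distr) (auto simp: indep_vars_def)
  have phi: "\<phi> = char (distr M borel (X 1))"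
    using ident by auto
  have [measurable]: "\<phi> \<in> borel_measurable borel"
    unfolding phi by (rule real_distribution.char_measurable[OF dist])
  let ?d = "\<lambda>w t. indicator {-T..T} t *\<^sub>R norm (empirical_char X n w t - \<phi> t)"
  have [measurable]: "(\<lambda>(w, t). empirical_char X n w t) \<in> borel_measurable (M \<Otimes>\<^sub>M lborel)"
    unfolding empirical_char_def by measurable
  have le2: "cmod (empirical_char X n w t - \<phi> t) \<le> 2" for w t
    using norm_triangle_ineq4[of "empirical_char X n w t" "\<phi> t"] cmod_empirical_char_le_1[of X n w t]
      real_distribution.cmod_char_le_1[OF dist, of t] unfolding phi by simp
  have int: "integrable (M \<Otimes>\<^sub>M lborel) (case_prod ?d)"
  proof (rule integrableI_bounded_set[where A="space M \<times> {-T..T}" and B=2])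
    show "emeasure (M \<Otimes>\<^sub>M lborel) (space M \<times> {-T..T}) < \<infinity>"
      using \<open>T \<ge> 0\<close> by (subst lborel.emeasure_pair_measure_Times) (auto simp: emeasure_space_1)
    show "AE z\<in>space M \<times> {-T..T} in M \<Otimes>\<^sub>M lborel. norm (case_prod ?d z) \<le> 2"
      using le2 by (auto split: split_indicator)
    show "AE z in M \<Otimes>\<^sub>M lborel. z \<notin> space M \<times> {-T..T} \<longrightarrow> case_prod ?d z = 0"
      by (rule AE_I2) (auto simp: space_pair_measure indicator_def split: if_splits)
  qed auto
  have intD: "integrable M D"
    unfolding D_def by (rule integrable_fst[OF int])
  then show "D \<in> borel_measurable M" by auto
  have "expectation D = (LBINT t. expectation (\<lambda>w. ?d w t))"
    unfolding D_def by (rule Fubini_integral[OF int, symmetric])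
  also have "\<dots> \<le> (LBINT t. indicator {-T..T} t *\<^sub>R (2 / sqrt n))"
  proof (rule integral_mono)
    show "integrable lborel (\<lambda>t. expectation (\<lambda>w. ?d w t))"
      by (rule integrable_snd[OF int])
    show "expectation (\<lambda>w. ?d w t) \<le> indicator {-T..T} t *\<^sub>R (2 / sqrt n)" for t
      using expectation_empirical_char_deviation_le[OF indep ident \<open>n \<ge> 1\<close>, of t]
      by (auto split: split_indicator)
  qed (use \<open>T \<ge> 0\<close> in auto)
  also have "\<dots> = 4 * T / sqrt n"
    using \<open>T \<ge> 0\<close> by simp
  finally have E: "expectation D \<le> 4 * T / sqrt n" .
  have "prob {w \<in> space M. D w \<ge> c} \<le> expectation D / c"
    using \<open>c > 0\<close> by (intro integral_Markov_inequality_measure[OF intD sets.top]) (auto simp: D_def)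
  also have "\<dots> \<le> 4 * T / sqrt n / c"
    using E \<open>c > 0\<close> by (intro divide_right_mono) auto
  finally show "prob {w \<in> space M. D w \<ge> c} \<le> 4 * T / (c * sqrt n)"
    by (simp add: mult.commute)
qed

section \<open>Separation of a unique mode\<close>

text \<open>
  Integrability alone does not make \<open>f\<close> small far out, but by uniform continuity every value above \<open>c\<close>
  forces a fixed amount of mass on an interval of fixed length next to it.
\<close>
lemma vanishes_at_infinity:
  fixes f :: "real \<Rightarrow> real"
  assumes nonneg: "\<And>x. f x \<ge> 0" and uc: "uniformly_continuous_on UNIV f"
    and int: "integrable lborel f" and "c > 0"
  shows "\<exists>R. \<forall>x. R < \<bar>x\<bar> \<longrightarrow> f x < c"
proof (rule ccontr)
  assume "\<not> ?thesis"
  then have "\<forall>k::nat. \<exists>x. real k < \<bar>x\<bar> \<and> c \<le> f x" by (meson linorder_not_le)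
  then obtain x where x: "\<And>k::nat. real k < \<bar>x k\<bar>" "\<And>k. c \<le> f (x k)" by metis
  obtain d where d: "d > 0" "\<And>y z. \<bar>y - z\<bar> < d \<Longrightarrow> \<bar>f y - f z\<bar> < c / 2"
    using uc \<open>c > 0\<close> unfolding uniformly_continuous_on_def dist_real_def
    by (metis UNIV_I half_gt_zero)
  \<comment> \<open>The intervals leave every bounded set, so the mass of \<open>f\<close> on them tends to 0;
    but \<open>f\<close> is at least \<open>c / 2\<close> on each of them.\<close>
  have "(\<lambda>k. LBINT y. indicator {x k<..<x k + d} y *\<^sub>R f y) \<longlonglongrightarrow> (LBINT y::real. (0::real))"
  proof (rule integral_dominated_convergence[where w=f])
    show "AE y in lborel. (\<lambda>k. indicator {x k<..<x k + d} y *\<^sub>R f y) \<longlonglongrightarrow> 0"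
    proof (rule AE_I2)
      fix y :: real
      obtain N :: nat where N: "\<bar>y\<bar> + d < real N" using reals_Archimedean2 by blast
      have "indicator {x k<..<x k + d} y *\<^sub>R f y = 0" if "k \<ge> N" for k
        using x(1)[of k] N that by (auto split: split_indicator)
      then show "(\<lambda>k. indicator {x k<..<x k + d} y *\<^sub>R f y) \<longlonglongrightarrow> 0"
        by (intro tendsto_eventually eventually_sequentiallyI[of N]) auto
    qed
  qed (use int nonneg in \<open>auto split: split_indicator\<close>)
  moreover have "c / 2 * d \<le> (LBINT y. indicator {x k<..<x k + d} y *\<^sub>R f y)" for k
  proof -
    have "c / 2 * d = (LBINT y. indicator {x k<..<x k + d} y *\<^sub>R (c / 2))"
      using d(1) by simp
    also have "\<dots> \<le> (LBINT y. indicator {x k<..<x k + d} y *\<^sub>R f y)"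
    proof (rule integral_mono)
      show "integrable lborel (\<lambda>y. indicator {x k<..<x k + d} y *\<^sub>R f y)"
        by (rule integrable_mult_indicator[OF _ int]) auto
      show "indicator {x k<..<x k + d} y *\<^sub>R (c / 2) \<le> indicator {x k<..<x k + d} y *\<^sub>R f y" for y
      proof (cases "y \<in> {x k<..<x k + d}")
        case True
        then have "\<bar>f y - f (x k)\<bar> < c / 2" by (intro d(2)) auto
        then have "c / 2 \<le> f y" using x(2)[of k] by linarith
        then show ?thesis by (intro scaleR_left_mono) auto
      qed simp
    qed (use d(1) in auto)
    finally show ?thesis .
  qed
  ultimately have "c / 2 * d \<le> 0"
    by (intro LIMSEQ_le_const) auto
  with \<open>c > 0\<close> d(1) show False by (simp add: mult_le_0_iff)
qed

text \<open>
  Uniqueness of the mode only says \<open>f x < f \<theta>\<close> for each \<open>x \<noteq> \<theta>\<close>.  That this holds with a uniform gap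
  away from \<open>\<theta>\<close> is what turns uniform closeness of functions into closeness of modes; without decay
  at infinity the values could approach the maximum along an escaping sequence.
\<close>
lemma unique_mode_well_separated:
  fixes f :: "real \<Rightarrow> real"
  assumes cont: "continuous_on UNIV f"
    and vanish: "\<And>c. c > 0 \<Longrightarrow> \<exists>R. \<forall>x. R < \<bar>x\<bar> \<longrightarrow> f x < c"
    and pos: "f \<theta> > 0" and mode: "is_mode f \<theta>"
    and unique: "\<And>x. is_mode f x \<Longrightarrow> x = \<theta>" and "\<epsilon> > 0"
  shows "\<exists>\<delta>>0. \<forall>x. \<epsilon> < \<bar>x - \<theta>\<bar> \<longrightarrow> f x \<le> f \<theta> - \<delta>"
proof -
  obtain R where R: "\<And>x. R < \<bar>x\<bar> \<Longrightarrow> f x < f \<theta> / 2"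
    using vanish[of "f \<theta> / 2"] pos by auto
  \<comment> \<open>Outside \<open>{-R..R}\<close> the gap is at least half the maximum, so only a compact set is left,
    and there \<open>f\<close> attains its supremum at a point that is not a mode.\<close>
  let ?K = "{-R..R} - {\<theta> - \<epsilon><..<\<theta> + \<epsilon>}"
  show ?thesis
  proof (cases "?K = {}")
    case True
    have "f x \<le> f \<theta> - f \<theta> / 2" if "\<epsilon> < \<bar>x - \<theta>\<bar>" for x
    proof -
      have "x \<notin> {\<theta> - \<epsilon><..<\<theta> + \<epsilon>}" using that by (auto simp: abs_if split: if_splits)
      with True have "x \<notin> {-R..R}" by blast
      then have "R < \<bar>x\<bar>" by auto
      from R[OF this] show ?thesis by linarith
    qed
    with pos show ?thesis by (intro exI[of _ "f \<theta> / 2"]) auto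
  next
    case False
    have "compact ?K" by (intro compact_diff) auto
    from continuous_attains_sup[OF this False continuous_on_subset[OF cont]]
    obtain y where y: "y \<in> ?K" "\<And>x. x \<in> ?K \<Longrightarrow> f x \<le> f y" by blast
    have "f y < f \<theta>"
    proof (rule ccontr)
      assume "\<not> f y < f \<theta>"
      then have "is_mode f y"
        using mode unfolding is_mode_def by (meson not_less order_trans)
      with unique y(1) \<open>\<epsilon> > 0\<close> show False by force
    qed
    moreover have "f x \<le> f \<theta> - min (f \<theta> / 2) (f \<theta> - f y)" if "\<epsilon> < \<bar>x - \<theta>\<bar>" for x
    proof (cases "x \<in> ?K")
      case False
      with that have "R < \<bar>x\<bar>" by auto
      from R[OF this] show ?thesis by linarith
    qed (use y(2) in force)
    ultimately show ?thesis
      using pos by (intro exI[of _ "min (f \<theta> / 2) (f \<theta> - f y)"]) auto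
  qed
qed

section \<open>Consistency of the estimated mode\<close>

lemma tendsto_integral_outside_interval:
  fixes g :: "real \<Rightarrow> real"
  assumes int: "integrable lborel g" and T: "filterlim T at_top sequentially"
  shows "(\<lambda>n. LBINT t. indicator (- {-T n..T n}) t *\<^sub>R g t) \<longlonglongrightarrow> 0"
proof -
  have "(\<lambda>n. LBINT t. indicator (- {-T n..T n}) t *\<^sub>R g t) \<longlonglongrightarrow> (LBINT t::real. (0::real))"
  proof (rule integral_dominated_convergence[where w="\<lambda>t. norm (g t)"])
    show "AE t in lborel. (\<lambda>n. indicator (- {-T n..T n}) t *\<^sub>R g t) \<longlonglongrightarrow> 0"
    proof (rule AE_I2)
      fix t :: real
      have "\<forall>\<^sub>F n in sequentially. \<bar>t\<bar> \<le> T n"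
        using T by (auto simp: filterlim_at_top)
      then have "\<forall>\<^sub>F n in sequentially. indicator (- {-T n..T n}) t *\<^sub>R g t = 0"
        by eventually_elim (auto split: split_indicator)
      then show "(\<lambda>n. indicator (- {-T n..T n}) t *\<^sub>R g t) \<longlonglongrightarrow> 0"
        by (rule tendsto_eventually)
    qed
  qed (use int in \<open>auto split: split_indicator\<close>)
  then show ?thesis by simp
qed

theorem theorem7p2:
  fixes M :: "'a measure"
    and X :: "nat \<Rightarrow> 'a \<Rightarrow> real"
    and f :: "real \<Rightarrow> real"
    and \<phi> :: "real \<Rightarrow> complex"
    and \<theta> :: real
    and h :: "nat \<Rightarrow> real"
    and \<theta>n :: "nat \<Rightarrow> 'a \<Rightarrow> real"
  assumes "prob_space M"
    and "prob_space.indep_vars M (\<lambda>_. borel) X {1..}"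
    and "\<And>x. f x \<ge> 0"
    and "\<And>j. j \<ge> 1 \<Longrightarrow> distributed M lborel (X j) (\<lambda>x. ennreal (f x))"
    and "\<phi> = char (distr M borel (X 1))"
    and "integrable lborel \<phi>"
    and "uniformly_continuous_on UNIV f"
    and "is_mode f \<theta>"
    and "\<And>x. is_mode f x \<Longrightarrow> x = \<theta>"
    and "\<And>n. n \<ge> 1 \<Longrightarrow> h n > 0"
    and "h \<longlonglongrightarrow> 0"
    and "filterlim (\<lambda>n. real n * (h n)\<^sup>2) at_top sequentially"
    and "\<And>n. n \<ge> 1 \<Longrightarrow> \<theta>n n \<in> borel_measurable M"
    and "\<And>n. n \<ge> 1 \<Longrightarrow> AE w in M. is_mode (sinc_estimator X n (h n) w) (\<theta>n n w)"
  shows "converges_in_probability M \<theta>n \<theta>"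
proof -
  interpret prob_space M by fact
  note indep = assms(2) and nonneg = assms(3) and dens = assms(4) and phi = assms(5)
    and phi_int = assms(6) and uc = assms(7) and mode = assms(8) and unique = assms(9)
    and h_pos = assms(10) and h_lim = assms(11) and nh = assms(12)
  let ?P = "density lborel (\<lambda>x. ennreal (f x))"
  have rv: "X j \<in> borel_measurable M" if "j \<ge> 1" for j
    using indep that by (auto simp: indep_vars_def)
  have distr: "distr M borel (X j) = ?P" if "j \<ge> 1" for j
  proof -
    have "distr M borel (X j) = distr M lborel (X j)"
      by (rule distr_cong) auto
    then show ?thesis using dens[OF that] by (simp add: distributed_def)
  qed
  have P: "real_distribution ?P"
    using real_distribution_distr[OF rv[of 1]] distr[of 1] by simp
  have phi_P: "\<phi> = char ?P"
    using phi distr[of 1] by simp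
  have ident: "char (distr M borel (X j)) t = \<phi> t" if "j \<ge> 1" for j t
    using that by (simp add: distr phi_P)
  have cont: "continuous_on UNIV f"
    using uc by (rule uniformly_continuous_imp_continuous)
  then have [measurable]: "f \<in> borel_measurable borel"
    by (rule borel_measurable_continuous_onI)
  have inversion: "complex_of_real (f x) = 1 / (2 * pi) * (CLBINT t. iexp (-(t * x)) * \<phi> t)" for x
    unfolding phi_P
    by (rule continuous_density_eq_inverse_Fourier[OF nonneg cont P phi_int[unfolded phi_P]])
  interpret P: real_distribution ?P by (rule P)
  have mass: "(\<integral>\<^sup>+x. ennreal (f x) \<partial>lborel) = 1"
    using P.emeasure_space_1 by (simp add: emeasure_density)
  have f_int: "integrable lborel f"
    by (rule integrableI_nonneg) (use nonneg mass in auto)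
  have pos: "f \<theta> > 0"
  proof (rule ccontr)
    assume "\<not> f \<theta> > 0"
    then have "f x = 0" for x
      using nonneg[of x] mode unfolding is_mode_def by (meson antisym not_less order_trans)
    with mass show False by simp
  qed
  have separated: "\<exists>\<delta>>0. \<forall>x. \<epsilon> < \<bar>x - \<theta>\<bar> \<longrightarrow> f x \<le> f \<theta> - \<delta>" if "\<epsilon> > 0" for \<epsilon>
    by (rule unique_mode_well_separated[OF cont _ pos mode _ that])
       (rule vanishes_at_infinity[OF nonneg uc f_int] unique, assumption)+
  let ?D = "\<lambda>n w. LBINT t. indicator {-(1 / h n)..1 / h n} t *\<^sub>R norm (empirical_char X n w t - \<phi> t)"
  let ?R = "\<lambda>n. LBINT t. indicator (- {-(1 / h n)..1 / h n}) t *\<^sub>R norm (\<phi> t)"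
  have h_right: "filterlim h (at_right 0) sequentially"
    by (rule tendsto_imp_filterlim_at_right[OF h_lim eventually_sequentiallyI[of 1]]) (rule h_pos)
  have R: "?R \<longlonglongrightarrow> 0"
    using filterlim_compose[OF filterlim_inverse_at_top_right h_right]
    by (intro tendsto_integral_outside_interval integrable_norm phi_int) (simp add: inverse_eq_divide)
  show ?thesis
    unfolding converges_in_probability_def
  proof (intro allI impI)
    fix \<epsilon> :: real assume "\<epsilon> > 0"
    from separated[OF this] obtain \<delta> where \<delta>: "\<delta> > 0" "\<And>x. \<epsilon> < \<bar>x - \<theta>\<bar> \<Longrightarrow> f x \<le> f \<theta> - \<delta>"
      by blast
    have bound: "prob {w \<in> space M. \<bar>\<theta>n n w - \<theta>\<bar> > \<epsilon>} \<le> 8 / \<delta> * inverse (sqrt (real n * (h n)\<^sup>2))"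
      if "n \<ge> 1" "?R n < \<delta> / 2" for n
    proof -
      have "prob {w \<in> space M. \<bar>\<theta>n n w - \<theta>\<bar> > \<epsilon>} \<le> prob {w \<in> space M. ?D n w \<ge> \<delta> / 2}"
      proof (rule finite_measure_mono_AE)
        show "AE w in M. w \<in> {w \<in> space M. \<bar>\<theta>n n w - \<theta>\<bar> > \<epsilon>} \<longrightarrow> w \<in> {w \<in> space M. ?D n w \<ge> \<delta> / 2}"
          using assms(14)[OF \<open>n \<ge> 1\<close>]
        proof (eventually_elim, intro impI)
          fix w assume mode_n: "is_mode (sinc_estimator X n (h n) w) (\<theta>n n w)"
            and "w \<in> {w \<in> space M. \<bar>\<theta>n n w - \<theta>\<bar> > \<epsilon>}"
          then have w: "w \<in> space M" and far: "\<epsilon> < \<bar>\<theta>n n w - \<theta>\<bar>" by auto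
          let ?e = "1 / (2 * pi) * (?D n w + ?R n)"
          have err: "\<bar>sinc_estimator X n (h n) w x - f x\<bar> \<le> ?e" for x
            by (rule sinc_estimator_error_le[OF h_pos[OF \<open>n \<ge> 1\<close>] phi_int inversion])
          have "sinc_estimator X n (h n) w \<theta> \<le> sinc_estimator X n (h n) w (\<theta>n n w)"
            using mode_n by (simp add: is_mode_def)
          \<comment> \<open>The error is paid twice: once in passing from \<open>f\<close> to its estimate at the estimated
            mode, once in passing back at \<open>\<theta>\<close>.\<close>
          then have "\<delta> \<le> 2 * ?e"
            using err[of \<theta>] err[of "\<theta>n n w"] \<delta>(2)[OF far] by linarith
          then have "\<delta> * pi \<le> ?D n w + ?R n"
            by (simp add: field_simps)
          moreover have "\<delta> * 1 \<le> \<delta> * pi"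
            using \<delta>(1) pi_ge_two by (intro mult_left_mono) auto
          ultimately have "\<delta> / 2 \<le> ?D n w"
            using that(2) by linarith
          with w show "w \<in> {w \<in> space M. ?D n w \<ge> \<delta> / 2}"
            by simp
        qed
        have "?D n \<in> borel_measurable M"
          by (rule prob_integrated_empirical_char_deviation_ge(1)[OF indep ident \<open>n \<ge> 1\<close>, where c=1])
             (use h_pos[OF \<open>n \<ge> 1\<close>] in auto)
        then show "{w \<in> space M. ?D n w \<ge> \<delta> / 2} \<in> sets M"
          by (intro borel_measurable_le borel_measurable_const)
      qed
      also have "\<dots> \<le> 4 * (1 / h n) / (\<delta> / 2 * sqrt n)"
        by (rule prob_integrated_empirical_char_deviation_ge(2)[OF indep ident \<open>n \<ge> 1\<close>])
           (use h_pos[OF \<open>n \<ge> 1\<close>] \<delta>(1) in auto)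
      also have "\<dots> = 8 / \<delta> * inverse (sqrt (real n * (h n)\<^sup>2))"
        using h_pos[OF \<open>n \<ge> 1\<close>] \<delta>(1) by (simp add: real_sqrt_mult field_simps)
      finally show ?thesis .
    qed
    have "(\<lambda>n. 8 / \<delta> * inverse (sqrt (real n * (h n)\<^sup>2))) \<longlonglongrightarrow> 8 / \<delta> * 0"
      by (intro tendsto_mult tendsto_const tendsto_inverse_0_at_top
            filterlim_compose[OF sqrt_at_top nh])
    then have lim: "(\<lambda>n. 8 / \<delta> * inverse (sqrt (real n * (h n)\<^sup>2))) \<longlonglongrightarrow> 0"
      by simp
    have "\<forall>\<^sub>F n in sequentially. ?R n < \<delta> / 2"
      using R \<delta>(1) by (intro order_tendstoD) auto
    then have "\<forall>\<^sub>F n in sequentially. prob {w \<in> space M. \<bar>\<theta>n n w - \<theta>\<bar> > \<epsilon>} \<le> 8 / \<delta> * inverse (sqrt (real n * (h n)\<^sup>2))"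
      using eventually_ge_at_top[of 1] by eventually_elim (rule bound)
    then show "(\<lambda>n. prob {w \<in> space M. \<bar>\<theta>n n w - \<theta>\<bar> > \<epsilon>}) \<longlonglongrightarrow> 0"
      by (intro tendsto_sandwich[OF _ _ tendsto_const lim]) auto
  qed
qed

end
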